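(* Let $N\ge 2$ and let $\mathcal G$ be a connected undirected graph on $\{1,\dots,N\}$ with positive edge weights $b_{ij}$, with weighted Laplacian $L_B$ having eigenvalues $0=\lambda_1<\lambda_2\le\dots\le\lambda_N$. Let $m,\tau,k,\alpha,\gamma>0$. Then the systems $H_{\mathrm{std}}$ and $H_{\mathrm{DAPI}}$ (defined in the context) have finite $\mathcal H_2$ norms given by $$\|H_{\mathrm{std}}\|_2^2=\frac{\alpha}{2m}(N-1),$$ $$\|H_{\mathrm{DAPI}}\|_2^2=\frac{\alpha}{2m}\sum_{n=2}^N \frac{1}{1+\dfrac{\gamma\tau\lambda_n+k}{\gamma\lambda_n(\gamma\tau\lambda_n+k)+k^2 m\lambda_n}}.$$
   Context: $L_B$ is the weighted graph Laplacian: $(L_B)_{ii}=\sum_{j\sim i} b_{ij}$, $(L_B)_{ij}=-b_{ij}$ if $i\sim j$, $i\neq j$, and $0$ otherwise. Set $L_G=\alpha L_B$ (conductance Laplacian, uniform resistance-to-reactance ratio $\alpha$) and $L_C=\gamma L_B$ (communication Laplacian); $L_G^{1/2}$ is the unique positive semidefinite square root of $L_G$. $I$ is the $N\times N$ identity. Standard droop control system $H_{\mathrm{std}}$: state $(\theta,\omega)\in\mathbb R^{2N}$, input $w\in\mathbb R^N$, output $y\in\mathbb R^N$, $\dot\theta=\omega$, $\dot\omega=-\tfrac{m}{\tau}L_B\theta-\tfrac1\tau\omega+\tfrac1\tau w$, $y=L_G^{1/2}\theta$; i.e. $A_{\mathrm{std}}=\begin{bmatrix}0&I\\-\frac m\tau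 L_B&-\frac1\tau I\end{bmatrix}$, $B_{\mathrm{std}}=\begin{bmatrix}0\\ \frac1\tau I\end{bmatrix}$, $C_{\mathrm{std}}=\begin{bmatrix}L_G^{1/2}&0\end{bmatrix}$. Distributed averaging PI (DAPI) system $H_{\mathrm{DAPI}}$: state $(\theta,\omega,\Omega)\in\mathbb R^{3N}$, $\dot\theta=\omega$, $\dot\omega=-\tfrac m\tau L_B\theta-\tfrac1\tau\omega+\tfrac1\tau\Omega+\tfrac1\tau w$, $\dot\Omega=-\tfrac1k\omega-\tfrac1k L_C\Omega$, $y=L_G^{1/2}\theta$; i.e. $A_{\mathrm{DAPI}}=\begin{bmatrix}0&I&0\\-\frac m\tau L_B&-\frac1\tau I&\frac1\tau I\\0&-\frac1k I&-\frac1k L_C\end{bmatrix}$, $B_{\mathrm{DAPI}}=\begin{bmatrix}0\\\frac1\tau I\\0\end{bmatrix}$, $C_{\mathrm{DAPI}}=\begin{bmatrix}L_G^{1/2}&0&0\end{bmatrix}$. For a system $(A,B,C)$, $\|H\|_2^2:=\int_0^\infty \operatorname{tr}\big(Ce^{At}BB^Te^{A^Tt}C^T\big)\,dt$ (the zero mode of $L_B$ is unobservable from $y$). This quantity equals the steady-state expected value $\lim_{t\to\infty}\mathbb E[y^Ty]$ under unit white-noise input $w$, interpreted as expected transient resistive power loss $\theta^TL_G\theta$. *)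

theory Defs
  imports "HOL-Analysis.Analysis"
begin

primrec mpow :: "real^'m^'m \<Rightarrow> nat \<Rightarrow> real^'m^'m" where
  "mpow A 0 = mat 1"
| "mpow A (Suc k) = A ** mpow A k"

definition mexp :: "real^'m^'m \<Rightarrow> real^'m^'m" where
  "mexp A = (\<Sum>k. (1 / fact k) *\<^sub>R mpow A k)"

definition psd :: "real^'n^'n \<Rightarrow> bool" where
  "psd S \<longleftrightarrow> transpose S = S \<and> (\<forall>x. 0 \<le> x \<bullet> (S *v x))"

definition psd_sqrt :: "real^'n^'n \<Rightarrow> real^'n^'n" where
  "psd_sqrt M = (THE S. psd S \<and> S ** S = M)"

definition laplacian :: "('n::finite \<Rightarrow> 'n \<Rightarrow> bool) \<Rightarrow> ('n \<Rightarrow> 'n \<Rightarrow> real) \<Rightarrow> real^'n^'n" where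
  "laplacian E b = (\<chi> i j. if i = j then (\<Sum>k\<in>{k. E i k}. b i k)
                           else if E i j then - b i j else 0)"

definition h2_integrand :: "real^'s^'s \<Rightarrow> real^'u^'s \<Rightarrow> real^'s^'y \<Rightarrow> real \<Rightarrow> real" where
  "h2_integrand A B C t = trace (C ** mexp (t *\<^sub>R A) ** B ** transpose B
                                 ** transpose (mexp (t *\<^sub>R A)) ** transpose C)"

definition has_h2_norm_sq :: "real^'s^'s \<Rightarrow> real^'u^'s \<Rightarrow> real^'s^'y \<Rightarrow> real \<Rightarrow> bool" where
  "has_h2_norm_sq A B C v \<longleftrightarrow> (h2_integrand A B C has_integral v) {0..}"

definition idm :: "'n \<Rightarrow> 'n \<Rightarrow> real" where
  "idm i j = (if i = j then 1 else 0)"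

(* standard droop control: state index type 'n + 'n  (theta, omega) *)
definition A_std :: "real \<Rightarrow> real \<Rightarrow> real^'n^'n \<Rightarrow> real^('n+'n)^('n+'n)" where
  "A_std m \<tau> LB = (\<chi> i j. case (i, j) of
       (Inl a, Inl c) \<Rightarrow> 0
     | (Inl a, Inr c) \<Rightarrow> idm a c
     | (Inr a, Inl c) \<Rightarrow> - (m / \<tau>) * LB $ a $ c
     | (Inr a, Inr c) \<Rightarrow> - (1 / \<tau>) * idm a c)"

definition B_std :: "real \<Rightarrow> real^'n^('n+'n)" where
  "B_std \<tau> = (\<chi> i j. case i of Inl a \<Rightarrow> 0 | Inr a \<Rightarrow> (1 / \<tau>) * idm a j)"

definition C_std :: "real^'n^'n \<Rightarrow> real^('n+'n)^'n" where
  "C_std LG = (\<chi> i j. case j of Inl c \<Rightarrow> psd_sqrt LG $ i $ c | Inr c \<Rightarrow> 0)"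

(* DAPI: state index type 'n + 'n + 'n = 'n + ('n + 'n)  (theta, omega, Omega) *)
definition A_DAPI :: "real \<Rightarrow> real \<Rightarrow> real \<Rightarrow> real^'n^'n \<Rightarrow> real^'n^'n
                      \<Rightarrow> real^('n+'n+'n)^('n+'n+'n)" where
  "A_DAPI m \<tau> k LB LC = (\<chi> i j. case (i, j) of
       (Inl a, Inl c) \<Rightarrow> 0
     | (Inl a, Inr (Inl c)) \<Rightarrow> idm a c
     | (Inl a, Inr (Inr c)) \<Rightarrow> 0
     | (Inr (Inl a), Inl c) \<Rightarrow> - (m / \<tau>) * LB $ a $ c
     | (Inr (Inl a), Inr (Inl c)) \<Rightarrow> - (1 / \<tau>) * idm a c
     | (Inr (Inl a), Inr (Inr c)) \<Rightarrow> (1 / \<tau>) * idm a c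
     | (Inr (Inr a), Inl c) \<Rightarrow> 0
     | (Inr (Inr a), Inr (Inl c)) \<Rightarrow> - (1 / k) * idm a c
     | (Inr (Inr a), Inr (Inr c)) \<Rightarrow> - (1 / k) * LC $ a $ c)"

definition B_DAPI :: "real \<Rightarrow> real^'n^('n+'n+'n)" where
  "B_DAPI \<tau> = (\<chi> i j. case i of Inr (Inl a) \<Rightarrow> (1 / \<tau>) * idm a j | _ \<Rightarrow> 0)"

definition C_DAPI :: "real^'n^'n \<Rightarrow> real^('n+'n+'n)^'n" where
  "C_DAPI LG = (\<chi> i j. case j of Inl c \<Rightarrow> psd_sqrt LG $ i $ c | _ \<Rightarrow> 0)"

end

theory Submission
  imports Defs "HOL-Computational_Algebra.Polynomial"
begin

text \<open>The Laplacian has an orthonormal eigenbasis \<open>u\<^sub>i\<close> with eigenvalues \<open>d\<^sub>i\<close>, which diagonalises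
  all blocks of both systems at once. With \<open>Y = C exp(tA) B\<close>, the \<open>\<H>\<^sub>2\<close> integrand
  \<open>tr (Y Y\<^sup>T)\<close> is the sum of the \<open>\<bar>Y u\<^sub>i\<bar>\<^sup>2\<close>, and \<open>Y u\<^sub>i = sqrt (\<alpha> d\<^sub>i) x\<^sub>i(t) u\<^sub>i\<close>, where \<open>x\<^sub>i\<close> is the
  impulse response of a scalar system with at most three states. The zero mode contributes
  nothing. For \<open>d\<^sub>i > 0\<close> the scalar system is stable, and a quadratic form \<open>P\<close> in its state with
  \<open>P' = - x\<^sub>i\<^sup>2\<close> gives the integral of \<open>x\<^sub>i\<^sup>2\<close> as the value of \<open>P\<close> at the initial state. Connectedness makes
  \<open>0\<close> a simple eigenvalue, and comparing characteristic polynomials identifies the \<open>d\<^sub>i\<close> with the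
  given eigenvalues as multisets.\<close>

section \<open>Spectral decomposition of symmetric matrices\<close>

lemma symmetric_matrix_inner:
  fixes A :: "real^'n^'n"
  assumes "transpose A = A"
  shows "x \<bullet> (A *v y) = (A *v x) \<bullet> y"
  by (metis assms dot_lmul_matrix vector_transpose_matrix)

text \<open>Variational argument: the quadratic form of \<open>A\<close> attains a maximum
  \<open>\<mu>\<close> on the unit sphere of \<open>S\<close>, at some \<open>v\<close>. The
  residual \<open>y = A v - \<mu> v\<close> lies in \<open>S\<close> and is orthogonal to
  \<open>v\<close>; if it were nonzero, moving from \<open>v\<close> towards \<open>y\<close> would
  exceed the maximum.\<close>

lemma eigenvector_in_invariant_subspace:
  fixes A :: "real^'n^'n"
  assumes sym: "transpose A = A" and S: "subspace S"
    and inv: "\<And>x. x \<in> S \<Longrightarrow> A *v x \<in> S" and nz: "\<exists>x\<in>S. x \<noteq> 0"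
  obtains v \<mu> where "v \<in> S" "norm v = 1" "A *v v = \<mu> *\<^sub>R v"
proof -
  have "compact (S \<inter> sphere 0 1)"
    using closed_subspace[OF S] by (simp add: closed_Int_compact)
  moreover obtain w where w: "w \<in> S" "w \<noteq> 0" using nz by blast
  then have "(1 / norm w) *\<^sub>R w \<in> S \<inter> sphere 0 1"
    using S by (simp add: subspace_scale)
  then have "S \<inter> sphere 0 1 \<noteq> {}" by blast
  moreover have "continuous_on (S \<inter> sphere 0 1) (\<lambda>x. x \<bullet> (A *v x))"
    by (intro continuous_intros matrix_vector_mult_linear_continuous_on)
  ultimately obtain v where v: "v \<in> S \<inter> sphere 0 1"
    and max: "\<And>x. x \<in> S \<inter> sphere 0 1 \<Longrightarrow> x \<bullet> (A *v x) \<le> v \<bullet> (A *v v)"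
    using continuous_attains_sup by meson
  define \<mu> where "\<mu> = v \<bullet> (A *v v)"
  define y where "y = A *v v - \<mu> *\<^sub>R v"
  have vS: "v \<in> S" and v1: "norm v = 1" "v \<bullet> v = 1"
    using v by (auto simp: dot_square_norm)
  have yS: "y \<in> S" using S inv vS by (simp add: y_def subspace_diff subspace_scale)
  have vy: "v \<bullet> y = 0" by (simp add: y_def inner_diff_right \<mu>_def v1)
  have le: "x \<bullet> (A *v x) \<le> \<mu> * (x \<bullet> x)" if "x \<in> S" for x
  proof (cases "x = 0")
    case False
    have "((1 / norm x) *\<^sub>R x) \<bullet> (A *v ((1 / norm x) *\<^sub>R x)) \<le> \<mu>"
      unfolding \<mu>_def using that False S by (intro max) (simp add: subspace_scale)
    then show ?thesis
      using False by (simp add: matrix_vector_mult_scaleR dot_square_norm power2_eq_square field_simps)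
  qed simp
  have "y \<bullet> y = 0"
  proof (rule ccontr)
    assume "y \<bullet> y \<noteq> 0"
    then have yy: "y \<bullet> y > 0" by (simp add: less_le)
    define q where "q = \<mu> * (y \<bullet> y) - y \<bullet> (A *v y)"
    have yAv: "y \<bullet> (A *v v) = y \<bullet> y"
      using vy by (simp add: y_def inner_diff_right inner_commute)
    have vAy: "v \<bullet> (A *v y) = y \<bullet> y"
      using yAv symmetric_matrix_inner[OF sym, of v y] by (simp add: inner_commute)
    \<comment> \<open>Maximality at \<open>v + t *\<^sub>R y\<close>: the gain is linear in
      \<open>t\<close>, the loss only quadratic.\<close>
    have ineq: "2 * t * (y \<bullet> y) \<le> t\<^sup>2 * q" for t
    proof -
      have "(v + t *\<^sub>R y) \<bullet> (A *v (v + t *\<^sub>R y)) \<le> \<mu> * ((v + t *\<^sub>R y) \<bullet> (v + t *\<^sub>R y))"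
        using S vS yS by (intro le) (simp add: subspace_add subspace_scale)
      also have "(v + t *\<^sub>R y) \<bullet> (v + t *\<^sub>R y) = 1 + t\<^sup>2 * (y \<bullet> y)"
        using vy by (simp add: inner_add_left inner_add_right v1 inner_commute power2_eq_square)
      also have "(v + t *\<^sub>R y) \<bullet> (A *v (v + t *\<^sub>R y)) = \<mu> + 2 * t * (y \<bullet> y) + t\<^sup>2 * (y \<bullet> (A *v y))"
        by (simp add: matrix_vector_right_distrib matrix_vector_mult_scaleR inner_add_left
            inner_add_right yAv vAy \<mu>_def[symmetric] power2_eq_square algebra_simps)
      finally show ?thesis by (simp add: q_def algebra_simps)
    qed
    have q: "q > 0"
      using ineq[of 1] yy by (simp del: inner_gt_zero_iff)
    \<comment> \<open>This \<open>t\<close> minimises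
      \<open>t\<^sup>2 * q - 2 * t * (y \<bullet> y)\<close>, and the minimum is negative.\<close>
    have "2 * ((y \<bullet> y) / q) * (y \<bullet> y) \<le> ((y \<bullet> y) / q)\<^sup>2 * q" by (rule ineq)
    then show False
      using q mult_pos_pos[OF yy yy] by (simp add: power2_eq_square field_simps)
  qed
  then have "A *v v = \<mu> *\<^sub>R v" by (simp add: y_def)
  with vS v1 that show thesis by blast
qed

text \<open>An orthonormal set of eigenvectors of maximal cardinality spans: otherwise its orthogonal
  complement is invariant and contains a further eigenvector.\<close>

theorem symmetric_matrix_orthonormal_eigenbasis:
  fixes A :: "real^'n^'n"
  assumes sym: "transpose A = A"
  obtains u :: "'n \<Rightarrow> real^'n" and d :: "'n \<Rightarrow> real"
  where "\<And>i j. u i \<bullet> u j = (if i = j then 1 else 0)" "\<And>i. A *v u i = d i *\<^sub>R u i"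
proof -
  define good where "good B \<longleftrightarrow> pairwise orthogonal B \<and> (\<forall>v\<in>B. norm v = 1 \<and> (\<exists>\<mu>. A *v v = \<mu> *\<^sub>R v))"
    for B :: "(real^'n) set"
  have indep: "independent B" if "good B" for B
    using that by (intro pairwise_orthogonal_independent) (auto simp: good_def)
  have fin: "finite B" and card_le: "card B \<le> CARD('n)" if "good B" for B
    using indep[OF that] independent_bound[of B] by auto
  have "\<exists>B. good B \<and> (\<forall>B'. good B' \<longrightarrow> card B' \<le> card B)"
    by (rule ex_has_greatest_nat[of good "{}" card "Suc CARD('n)"])
      (auto simp: card_le less_Suc_eq_le, auto simp: good_def)
  then obtain B where B: "good B" and max: "\<And>B'. good B' \<Longrightarrow> card B' \<le> card B"
    by blast
  define S where "S = {x. \<forall>v\<in>B. x \<bullet> v = 0}"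
  have S: "subspace S"
    by (auto simp: S_def subspace_def inner_add_left)
  have inv: "A *v x \<in> S" if x: "x \<in> S" for x
  proof -
    have "(A *v x) \<bullet> v = 0" if "v \<in> B" for v
    proof -
      obtain \<mu> where "A *v v = \<mu> *\<^sub>R v" using B \<open>v \<in> B\<close> unfolding good_def by blast
      then show ?thesis
        using x that by (simp add: symmetric_matrix_inner[OF sym, symmetric] S_def)
    qed
    then show ?thesis by (simp add: S_def)
  qed
  have S0: "x = 0" if "x \<in> S" for x
  proof (rule ccontr)
    assume "x \<noteq> 0"
    with that obtain v \<mu> where v: "v \<in> S" "norm v = 1" "A *v v = \<mu> *\<^sub>R v"
      using eigenvector_in_invariant_subspace[OF sym S inv] by metis
    then have "good (insert v B)"
      using B by (auto simp: good_def S_def pairwise_insert orthogonal_def inner_commute)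
    moreover have "v \<notin> B"
      using v by (auto simp: S_def)
    ultimately show False using max[of "insert v B"] fin[OF B] by simp
  qed
  have "span B = UNIV"
  proof (rule ccontr)
    assume "span B \<noteq> UNIV"
    then obtain a where "a \<noteq> 0" "\<And>x. x \<in> span B \<Longrightarrow> a \<bullet> x = 0"
      using span_not_UNIV_orthogonal by blast
    then show False
      using S0[of a] by (auto simp: S_def span_base)
  qed
  \<comment> \<open>A basis has as many elements as the index type, so the eigenvectors can be
    indexed by \<open>'n\<close>.\<close>
  then have "card B = CARD('n)"
    using indep[OF B] by (metis dim_eq_card dim_UNIV DIM_cart DIM_real mult.right_neutral span_UNIV)
  then obtain u where u: "bij_betw u (UNIV :: 'n set) B"
    using fin[OF B] finite_same_card_bij[of "UNIV :: 'n set" B] by auto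
  have uB: "u i \<in> B" for i using u by (auto simp: bij_betw_def)
  have "\<forall>i. \<exists>\<mu>. A *v u i = \<mu> *\<^sub>R u i" using B uB by (auto simp: good_def)
  then obtain d where "\<And>i. A *v u i = d i *\<^sub>R u i" by metis
  moreover have "u i \<bullet> u j = (if i = j then 1 else 0)" for i j
  proof (cases "i = j")
    case True
    then show ?thesis using B uB by (auto simp: good_def dot_square_norm)
  next
    case False
    then have "u i \<noteq> u j" using u by (auto simp: bij_betw_def inj_on_def)
    then show ?thesis using B uB False by (auto simp: good_def pairwise_def orthogonal_def)
  qed
  ultimately show thesis using that by blast
qed

section \<open>Matrix algebra in an orthonormal eigenbasis\<close>

locale orthonormal_eigenbasis =
  fixes A :: "real^'n^'n" and u :: "'n \<Rightarrow> real^'n" and d :: "'n \<Rightarrow> real"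
  assumes orthonormal: "\<And>i j. u i \<bullet> u j = (if i = j then 1 else 0)"
    and eigen: "\<And>i. A *v u i = d i *\<^sub>R u i"
begin

definition U :: "real^'n^'n" where "U = (\<chi> i j. u j $ i)"

lemma column_U: "column j U = u j"
  by (simp add: U_def column_def vec_eq_iff)

lemma transpose_U_mult: "transpose U ** U = mat 1"
  using orthonormal
  by (simp add: U_def matrix_matrix_mult_def transpose_def mat_def vec_eq_iff inner_vec_def)

lemma U_mult_transpose: "U ** transpose U = mat 1"
  using transpose_U_mult by (simp add: matrix_left_right_inverse)

lemma column_matrix_mult: "column j (M ** U) = M *v u j" for M :: "real^'n^'m"
  by (simp add: U_def column_def matrix_matrix_mult_def matrix_vector_mult_def vec_eq_iff)

lemma matrix_eqI:
  fixes M M' :: "real^'n^'m"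
  assumes "\<And>i. M *v u i = M' *v u i"
  shows "M = M'"
proof -
  have "column j (M ** U) = column j (M' ** U)" for j
    using assms by (simp add: column_matrix_mult)
  then have "M ** U = M' ** U"
    by (simp add: column_def vec_eq_iff)
  then have "M ** (U ** transpose U) = M' ** (U ** transpose U)"
    by (simp add: matrix_mul_assoc)
  then show ?thesis by (simp add: U_mult_transpose)
qed

lemma vector_eq_0I:
  assumes "\<And>i. u i \<bullet> x = 0"
  shows "x = 0"
proof -
  have "transpose U *v x = 0"
    using assms by (simp add: U_def transpose_def matrix_vector_mult_def vec_eq_iff inner_vec_def)
  then have "(U ** transpose U) *v x = 0"
    by (simp add: matrix_vector_mul_assoc[symmetric])
  then show ?thesis by (simp add: U_mult_transpose)
qed

text \<open>The trace is the squared Frobenius norm of \<open>Y\<close>, which is unchanged when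
  \<open>Y\<close> is multiplied by the orthogonal matrix \<open>U\<close>; the columns of
  \<open>Y ** U\<close> are the vectors \<open>Y *v u i\<close>.\<close>

lemma trace_mult_transpose:
  fixes Y :: "real^'n^'m"
  shows "trace (Y ** transpose Y) = (\<Sum>i\<in>UNIV. (norm (Y *v u i))\<^sup>2)"
proof -
  have "Y ** transpose Y = (Y ** U) ** transpose (Y ** U)"
    by (metis U_mult_transpose matrix_mul_assoc matrix_mul_rid matrix_transpose_mul)
  then have "trace (Y ** transpose Y) = (\<Sum>i\<in>UNIV. \<Sum>j\<in>UNIV. ((Y ** U) $ i $ j)\<^sup>2)"
    by (simp add: trace_def matrix_matrix_mult_def transpose_def power2_eq_square)
  also have "\<dots> = (\<Sum>j\<in>UNIV. \<Sum>i\<in>UNIV. ((Y ** U) $ i $ j)\<^sup>2)"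
    by (rule sum.swap)
  also have "\<dots> = (\<Sum>j\<in>UNIV. (norm (column j (Y ** U)))\<^sup>2)"
    unfolding power2_norm_eq_inner by (simp add: column_def inner_vec_def power2_eq_square)
  finally show ?thesis by (simp add: column_matrix_mult)
qed

lemma det_charpoly: "det (mat x - A) = (\<Prod>i\<in>UNIV. x - d i)"
proof -
  define D :: "real^'n^'n" where "D = (\<chi> i j. if i = j then x - d i else 0)"
  have "column j ((mat x - A) ** U) = column j (U ** D)" for j
  proof -
    have "column j (U ** D) = (x - d j) *\<^sub>R u j"
      by (simp add: D_def U_def column_def matrix_matrix_mult_def vec_eq_iff if_distrib cong: if_cong)
    moreover have "mat x *v u j = x *\<^sub>R u j"
      by (simp add: mat_def matrix_vector_mult_def vec_eq_iff if_distrib if_distribR cong: if_cong)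
    ultimately show ?thesis
      by (simp add: column_matrix_mult matrix_vector_mult_diff_rdistrib eigen scaleR_diff_left)
  qed
  then have "(mat x - A) ** U = U ** D"
    by (simp add: column_def vec_eq_iff)
  then have "det (mat x - A) * det U = det U * det D"
    using det_mul[of "mat x - A" U] det_mul[of U D] by metis
  moreover have "det U * det U = 1"
    using transpose_U_mult by (metis det_I det_mul det_transpose)
  then have "det U \<noteq> 0" by auto
  ultimately have "det (mat x - A) = det D"
    by simp
  also have "\<dots> = (\<Prod>i\<in>UNIV. x - d i)"
    unfolding D_def by (subst det_diagonal) auto
  finally show ?thesis .
qed

text \<open>Since \<open>psd_sqrt\<close> is a definite description, both existence and uniqueness
  of the root are needed. \<open>U D U^T\<close> is one root. For any other root \<open>T\<close>,
  the vector \<open>v = T u - sqrt d u\<close> satisfies \<open>T v = - sqrt d v\<close>, and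
  positive semidefiniteness forces \<open>v = 0\<close>.\<close>

lemma psd_sqrt_eigen:
  assumes nonneg: "\<And>i. 0 \<le> d i"
  shows "psd_sqrt A *v u i = sqrt (d i) *\<^sub>R u i"
proof -
  define D :: "real^'n^'n" where "D = (\<chi> i j. if i = j then sqrt (d i) else 0)"
  define S where "S = U ** D ** transpose U"
  have D_mult: "D *v w = (\<chi> i. sqrt (d i) * w $ i)" for w
    by (simp add: D_def matrix_vector_mult_def vec_eq_iff if_distrib if_distribR cong: if_cong)
  have Ui: "transpose U *v u i = axis i 1" for i
    using orthonormal
    by (simp add: U_def transpose_def matrix_vector_mult_def vec_eq_iff inner_vec_def axis_def eq_commute)
  have Su: "S *v u i = sqrt (d i) *\<^sub>R u i" for i
  proof -
    have "D *v axis i 1 = sqrt (d i) *\<^sub>R axis i 1"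
      by (simp add: D_mult vec_eq_iff axis_def)
    moreover have "U *v axis i 1 = u i"
      by (simp add: matrix_vector_mult_basis column_U)
    ultimately show ?thesis
      by (simp add: S_def matrix_vector_mul_assoc[symmetric] Ui matrix_vector_mult_scaleR del: transpose_matrix_vector)
  qed
  have "S ** S = A"
    by (rule matrix_eqI) (simp add: matrix_vector_mul_assoc[symmetric] Su eigen
        matrix_vector_mult_scaleR nonneg)
  moreover have "psd S"
  proof -
    have D: "transpose D = D"
      by (auto simp: D_def transpose_def vec_eq_iff)
    have "transpose S = S"
      by (simp add: S_def matrix_transpose_mul D matrix_mul_assoc)
    moreover have "0 \<le> x \<bullet> (S *v x)" for x
    proof -
      define w where "w = transpose U *v x"
      have "x \<bullet> (S *v x) = w \<bullet> (D *v w)"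
        by (simp add: S_def w_def matrix_vector_mul_assoc[symmetric] dot_lmul_matrix[symmetric]
            vector_transpose_matrix)
      also have "\<dots> = (\<Sum>i\<in>UNIV. sqrt (d i) * (w $ i)\<^sup>2)"
        by (simp add: D_mult inner_vec_def power2_eq_square algebra_simps)
      also have "\<dots> \<ge> 0" by (simp add: sum_nonneg nonneg)
      finally show ?thesis .
    qed
    ultimately show ?thesis by (simp add: psd_def)
  qed
  moreover have "T = S" if T: "psd T" "T ** T = A" for T
  proof (rule matrix_eqI)
    fix i
    have sym: "transpose T = T" and nn: "\<And>x. 0 \<le> x \<bullet> (T *v x)"
      using T by (auto simp: psd_def)
    have TT: "T *v (T *v u i) = d i *\<^sub>R u i"
      using T(2) eigen by (simp add: matrix_vector_mul_assoc)
    define v where "v = T *v u i - sqrt (d i) *\<^sub>R u i"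
    have Tv: "T *v v = - sqrt (d i) *\<^sub>R v"
      using nonneg[of i] by (simp add: v_def matrix_vector_mult_diff_distrib TT
          matrix_vector_mult_scaleR scaleR_diff_right)
    have "v = 0"
    \<comment> \<open>For \<open>d i = 0\<close> the sign argument says nothing; there
      \<open>T (T u) = 0\<close> and symmetry give \<open>T u = 0\<close>.\<close>
    proof (cases "d i = 0")
      case True
      have "v \<bullet> v = (T *v u i) \<bullet> (T *v u i)" using True by (simp add: v_def)
      also have "\<dots> = u i \<bullet> (T *v (T *v u i))" by (simp add: symmetric_matrix_inner[OF sym])
      finally show ?thesis using TT True by simp
    next
      case False
      then have "0 < sqrt (d i)" using nonneg[of i] by (simp add: less_le)
      moreover have "0 \<le> - (sqrt (d i) * (v \<bullet> v))" using nn[of v] by (simp add: Tv)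
      ultimately have "v \<bullet> v \<le> 0" by (simp add: mult_le_0_iff)
      then show ?thesis by (metis inner_eq_zero_iff inner_ge_zero order_antisym)
    qed
    then show "T *v u i = S *v u i" by (simp add: v_def Su)
  qed
  ultimately have "psd_sqrt A = S"
    unfolding psd_sqrt_def by (intro the_equality) blast+
  then show ?thesis by (simp add: Su)
qed

end

section \<open>The scalar modal system\<close>

text \<open>Nonnegativity of \<open>f\<close> lets the improper integral be computed as a
  nonnegative Lebesgue integral and then carried over to the gauge integral.\<close>

lemma has_integral_FTC_atLeast_nonneg:
  fixes f F :: "real \<Rightarrow> real"
  assumes deriv: "\<And>x. (F has_real_derivative f x) (at x)"
    and cont: "continuous_on UNIV f"
    and nonneg: "\<And>x. 0 \<le> f x"
    and lim: "(F \<longlongrightarrow> l) at_top"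
  shows "(f has_integral (l - F a)) {a..}"
proof -
  have meas: "f \<in> borel_measurable borel"
    using cont by (rule borel_measurable_continuous_onI)
  have mono: "F a \<le> F x" if "a \<le> x" for x
    using that deriv nonneg by (intro DERIV_nonneg_imp_nondecreasing[of a x F]) auto
  \<comment> \<open>\<open>ennreal\<close> truncates negative numbers to zero, so the sign of
    \<open>l - F a\<close> has to be known.\<close>
  have "F a \<le> l"
    using lim by (rule tendsto_lowerbound) (auto intro!: eventually_mono[OF eventually_ge_at_top[of a]] mono)
  moreover have "(\<integral>\<^sup>+x. ennreal (f x) * indicator {a ..} x \<partial>lborel) = ennreal (l - F a)"
    using meas deriv nonneg lim by (intro nn_integral_FTC_atLeast) auto
  then have "(\<integral>\<^sup>+x. ennreal (indicator {a..} x * f x) \<partial>lborel) = ennreal (l - F a)"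
    by (simp add: ennreal_mult' mult.commute ennreal_indicator nonneg)
  moreover have "(\<lambda>x. indicator {a..} x * f x) \<in> borel_measurable borel"
    using meas by measurable
  ultimately have "((\<lambda>x. indicator {a..} x * f x) has_integral (l - F a)) UNIV"
    using nonneg by (intro nn_integral_has_integral) auto
  moreover have "(\<lambda>x. indicator {a..} x * f x) = (\<lambda>x. if x \<in> {a..} then f x else 0)"
    by (auto simp: indicator_def)
  ultimately show ?thesis
    by (simp only: has_integral_restrict_UNIV)
qed

text \<open>One eigenmode of the closed loop, with \<open>g = m * \<lambda>\<close> and \<open>c = \<gamma> * \<lambda>\<close>. The case \<open>\<sigma> = 1\<close> is DAPI;
  for \<open>\<sigma> = 0\<close> the state \<open>z\<close> decouples and \<open>(x, y)\<close> is the standard droop control.\<close>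

locale modal_system =
  fixes g \<tau> k c \<sigma> :: real and x y z :: "real \<Rightarrow> real"
  assumes pos: "g > 0" "\<tau> > 0" "k > 0" "c > 0"
    and x_deriv: "\<And>t. (x has_real_derivative y t) (at t)"
    and y_deriv: "\<And>t. (y has_real_derivative (\<sigma> * z t - g * x t - y t) / \<tau>) (at t)"
    and z_deriv: "\<And>t. (z has_real_derivative (- \<sigma> * y t - c * z t) / k) (at t)"
begin

definition energy :: "real \<Rightarrow> real" where
  "energy t = g * (x t)\<^sup>2 + \<tau> * (y t)\<^sup>2 + k * (z t)\<^sup>2"

text \<open>The weights \<open>g\<close>, \<open>\<tau>\<close>, \<open>k\<close> make all cross
  terms cancel. Only the damping of \<open>y\<close> and \<open>z\<close> remains; without an
  \<open>x\<close> term this alone does not give decay.\<close>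

lemma energy_deriv:
  "(energy has_real_derivative (- 2 * (y t)\<^sup>2 - 2 * c * (z t)\<^sup>2)) (at t)"
  unfolding energy_def using pos
  by (auto intro!: derivative_eq_intros x_deriv y_deriv z_deriv simp: field_simps power2_eq_square)

lemma energy_nonneg: "0 \<le> energy t"
  using pos by (simp add: energy_def)

text \<open>For large \<open>K\<close>, \<open>W = K * energy + 2 * \<tau> * x * y\<close> is nonnegative and decreases at a rate of
  at least \<open>energy\<close>. As \<open>energy\<close> decreases too, \<open>W + t * energy\<close> does, which bounds \<open>t * energy\<close>.\<close>

lemma energy_tendsto_0: "(energy \<longlongrightarrow> 0) at_top"
proof -
  \<comment> \<open>The summands \<open>2 * \<tau> + 1 / g\<close> control the \<open>y\<close>
    terms of the derivative of \<open>W\<close>, and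
    \<open>\<sigma>\<^sup>2 / (g * c) + k / c\<close> its \<open>z\<close> terms;
    \<open>\<tau> / g\<close> and \<open>1\<close> make \<open>W\<close> nonnegative.\<close>
  define K where "K = 2 * \<tau> + 1 / g + \<sigma>\<^sup>2 / (g * c) + k / c + \<tau> / g + 1"
  define W where "W t = K * energy t + 2 * \<tau> * (x t * y t)" for t
  have nn: "0 \<le> \<sigma>\<^sup>2 / (g * c)" "0 \<le> k / c" "0 \<le> \<tau> / g" "0 \<le> 1 / g"
    using pos by auto
  have "K * g = 2 * \<tau> * g + 1 + \<sigma>\<^sup>2 / c + k / c * g + \<tau> + g"
    using pos by (simp add: K_def field_simps)
  moreover have "0 \<le> \<sigma>\<^sup>2 / c" "0 \<le> k / c * g" "0 \<le> \<tau> * g"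
    using pos by auto
  ultimately have Kg: "\<tau> \<le> K * g" using pos by linarith
  have K1: "1 \<le> K" using nn pos by (simp add: K_def)
  have Ky: "2 * \<tau> + 1 / g \<le> K" using nn pos by (simp add: K_def)
  have "K * c = 2 * \<tau> * c + 1 / g * c + \<sigma>\<^sup>2 / g + k + \<tau> / g * c + c"
    using pos by (simp add: K_def field_simps)
  moreover have "0 \<le> \<tau> * c" "0 \<le> 1 / g * c" "0 \<le> \<tau> / g * c"
    using pos by auto
  ultimately have Kc: "\<sigma>\<^sup>2 / g + k \<le> K * c"
    using pos by linarith
  have W_nonneg: "0 \<le> W t" for t
  proof -
    have "0 \<le> \<tau> * (x t + y t)\<^sup>2" using pos by simp
    also have "\<dots> = \<tau> * (x t)\<^sup>2 + 1 * (\<tau> * (y t)\<^sup>2) + 2 * \<tau> * (x t * y t)"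
      by (simp add: power2_eq_square algebra_simps)
    also have "\<dots> \<le> K * g * (x t)\<^sup>2 + K * (\<tau> * (y t)\<^sup>2) + 2 * \<tau> * (x t * y t)"
      using Kg K1 pos by (intro add_right_mono add_mono mult_right_mono) auto
    also have "\<dots> \<le> W t"
      using mult_nonneg_nonneg[of K "k * (z t)\<^sup>2"] K1 pos
      by (simp add: W_def energy_def distrib_left mult.assoc)
    finally show ?thesis .
  qed
  define W' where "W' t = K * (- 2 * (y t)\<^sup>2 - 2 * c * (z t)\<^sup>2)
      + 2 * (\<tau> * (y t)\<^sup>2 + x t * (\<sigma> * z t - g * x t - y t))" for t
  have W_deriv: "(W has_real_derivative W' t) (at t)" for t
    unfolding W_def W'_def using pos
    by (auto intro!: derivative_eq_intros x_deriv y_deriv energy_deriv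
        simp: field_simps power2_eq_square)
  have W'_le: "W' t + energy t \<le> 0" for t
  proof -
    \<comment> \<open>The squares are weighted so that the two mixed terms, each occurring twice,
      together use up exactly the available \<open>- g * (x t)\<^sup>2\<close>.\<close>
    have "0 \<le> (g * x t / 2 + y t)\<^sup>2 / g" "0 \<le> (g * x t / 2 - \<sigma> * z t)\<^sup>2 / g"
      using pos by auto
    then have 1: "- (x t * y t) \<le> g * (x t)\<^sup>2 / 4 + 1 / g * (y t)\<^sup>2"
      and 2: "\<sigma> * (x t * z t) \<le> g * (x t)\<^sup>2 / 4 + \<sigma>\<^sup>2 / g * (z t)\<^sup>2"
      using pos by (simp_all add: power2_eq_square field_simps)
    have 3: "(2 * \<tau> + 1 / g) * (y t)\<^sup>2 \<le> K * (y t)\<^sup>2"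
      using Ky by (rule mult_right_mono) simp
    have 4: "(\<sigma>\<^sup>2 / g + k) * (z t)\<^sup>2 \<le> K * c * (z t)\<^sup>2"
      using Kc by (rule mult_right_mono) simp
    have 5: "0 \<le> \<tau> * (y t)\<^sup>2" "0 \<le> k * (z t)\<^sup>2" using pos by auto
    have "W' t + energy t = - 2 * (K * (y t)\<^sup>2) - 2 * (K * c * (z t)\<^sup>2) + 3 * (\<tau> * (y t)\<^sup>2)
        + 2 * (\<sigma> * (x t * z t)) - g * (x t)\<^sup>2 - 2 * (x t * y t) + k * (z t)\<^sup>2"
      by (simp add: W'_def energy_def power2_eq_square algebra_simps)
    then show ?thesis
      using 1 2 3 4 5 by (simp add: algebra_simps)
  qed
  have bound: "t * energy t \<le> W 0" if "0 \<le> t" for t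
  proof -
    have "W t + t * energy t \<le> W 0 + 0 * energy 0"
    proof (rule DERIV_nonpos_imp_nonincreasing[OF that, of "\<lambda>t. W t + t * energy t"])
      fix s :: real assume s: "0 \<le> s" "s \<le> t"
      have "((\<lambda>t. W t + t * energy t) has_real_derivative
          (W' s + (1 * energy s + s * (- 2 * (y s)\<^sup>2 - 2 * c * (z s)\<^sup>2)))) (at s)"
        by (auto intro!: derivative_eq_intros W_deriv energy_deriv)
      moreover have "s * (- 2 * (y s)\<^sup>2 - 2 * c * (z s)\<^sup>2) \<le> 0"
        using s pos mult_nonneg_nonneg[of c "(z s)\<^sup>2"]
        by (intro mult_nonneg_nonpos) (auto simp: mult.assoc intro: order_trans[of _ 0])
      then have "W' s + (1 * energy s + s * (- 2 * (y s)\<^sup>2 - 2 * c * (z s)\<^sup>2)) \<le> 0"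
        using W'_le[of s] by linarith
      ultimately show "\<exists>d. ((\<lambda>t. W t + t * energy t) has_real_derivative d) (at s) \<and> d \<le> 0"
        by blast
    qed
    then show ?thesis using W_nonneg[of t] by simp
  qed
  show ?thesis
  proof (rule tendsto_sandwich)
    show "\<forall>\<^sub>F t in at_top. 0 \<le> energy t" by (simp add: energy_nonneg)
    show "\<forall>\<^sub>F t in at_top. energy t \<le> W 0 / t"
      using eventually_gt_at_top[of 0]
      by eventually_elim (use bound in \<open>simp add: field_simps\<close>)
    show "((\<lambda>t. W 0 / t) \<longlongrightarrow> 0) at_top"
      by (intro tendsto_divide_0[OF tendsto_const] filterlim_at_top_imp_at_infinity filterlim_ident)
  qed simp
qed

lemma tendsto_0_of_square_le_energy:
  assumes "a > 0" "\<And>t. a * (f t)\<^sup>2 \<le> energy t"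
  shows "(f \<longlongrightarrow> 0) at_top"
proof -
  have "((\<lambda>t. (f t)\<^sup>2) \<longlongrightarrow> 0) at_top"
  proof (rule tendsto_sandwich[of "\<lambda>_. 0" _ _ "\<lambda>t. energy t / a"])
    show "((\<lambda>t. energy t / a) \<longlongrightarrow> 0) at_top"
      using tendsto_divide[OF energy_tendsto_0 tendsto_const[of a]] assms by simp
    show "\<forall>\<^sub>F t in at_top. (f t)\<^sup>2 \<le> energy t / a"
      using assms by (simp add: field_simps)
  qed auto
  then show ?thesis
    using tendsto_real_sqrt[of "\<lambda>t. (f t)\<^sup>2" 0 at_top] by (simp add: tendsto_rabs_zero_iff)
qed

lemma x_tendsto_0: "(x \<longlongrightarrow> 0) at_top"
  by (rule tendsto_0_of_square_le_energy[of g]) (use pos in \<open>auto simp: energy_def\<close>)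

lemma y_tendsto_0: "(y \<longlongrightarrow> 0) at_top"
  by (rule tendsto_0_of_square_le_energy[of \<tau>]) (use pos in \<open>auto simp: energy_def\<close>)

lemma z_tendsto_0: "(z \<longlongrightarrow> 0) at_top"
  by (rule tendsto_0_of_square_le_energy[of k]) (use pos in \<open>auto simp: energy_def\<close>)

lemma has_integral_square:
  assumes init: "x 0 = 0" "y 0 = 1 / \<tau>" "z 0 = 0"
  defines "X \<equiv> c * (\<tau> * c + k) + k\<^sup>2 * g"
  shows "((\<lambda>t. (x t)\<^sup>2) has_integral X / (2 * g * (X + \<sigma>\<^sup>2 * (\<tau> * c + k)))) {0..}"
proof -
  define D where "D = X + \<sigma>\<^sup>2 * (\<tau> * c + k)"
  have X: "X > 0" using pos unfolding X_def by (intro add_pos_pos mult_pos_pos) auto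
  then have D: "D > 0" using pos unfolding D_def by (intro add_pos_nonneg) auto
  \<comment> \<open>The equations \<open>eqs\<close> determine \<open>p12\<close> and express
    \<open>p22\<close>, \<open>p33\<close>, \<open>p13\<close>, \<open>p11\<close> through
    \<open>p12\<close> and \<open>p23\<close>. Substituted into the remaining equation
    \<open>eq\<close>, they leave a linear equation for \<open>p23\<close> with coefficient
    \<open>D\<close>, up to a nonzero factor.\<close>
  define p12 where "p12 = \<tau> / (2 * g)"
  define p23 where "p23 = \<sigma> * p12 * k * (\<tau> * c + k) / D"
  define p22 where "p22 = \<tau> * (p12 - \<sigma> / k * p23)"
  define p33 where "p33 = \<sigma> * k * p23 / (\<tau> * c)"
  define p13 where "p13 = k * (\<sigma> * p12 - g * p23) / (\<tau> * c)"
  define p11 where "p11 = p12 / \<tau> + g / \<tau> * p22 + \<sigma> / k * p13"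
  \<comment> \<open>The coefficients solve the Lyapunov equation for \<open>P' = - x\<^sup>2\<close>: one linear equation per monomial.\<close>
  define P where "P t = p11 * (x t)\<^sup>2 + 2 * p12 * (x t * y t) + p22 * (y t)\<^sup>2
      + 2 * p13 * (x t * z t) + 2 * p23 * (y t * z t) + p33 * (z t)\<^sup>2" for t
  have eqs: "2 * (g / \<tau>) * p12 = 1"
      "p11 - 1 / \<tau> * p12 - g / \<tau> * p22 - \<sigma> / k * p13 = 0"
      "\<sigma> / \<tau> * p12 - c / k * p13 - g / \<tau> * p23 = 0"
      "p12 - 1 / \<tau> * p22 - \<sigma> / k * p23 = 0"
      "\<sigma> / \<tau> * p23 - c / k * p33 = 0"
    using pos by (simp_all add: p12_def p11_def p13_def p22_def p33_def field_simps)
  have eq: "\<sigma> / \<tau> * p22 + p13 - 1 / \<tau> * p23 - c / k * p23 - \<sigma> / k * p33 = 0"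
  proof -
    have "\<sigma> / \<tau> * p22 + p13 - 1 / \<tau> * p23 - c / k * p23 - \<sigma> / k * p33
        = (\<sigma> * p12 * k * (\<tau> * c + k) - p23 * D) / (\<tau> * c * k)"
      using pos unfolding D_def X_def p22_def p13_def p33_def
      by (simp add: field_simps power2_eq_square)
    then show ?thesis using D by (simp add: p23_def)
  qed
  have P_deriv: "((\<lambda>t. - P t) has_real_derivative (x t)\<^sup>2) (at t)" for t
  proof -
    define y' z' where "y' = (\<sigma> * z t - g * x t - y t) / \<tau>" and "z' = (- \<sigma> * y t - c * z t) / k"
    have "((\<lambda>t. - P t) has_real_derivative
        - (p11 * (2 * x t * y t) + 2 * p12 * (y t * y t + x t * y') + p22 * (2 * y t * y')
          + 2 * p13 * (y t * z t + x t * z') + 2 * p23 * (y' * z t + y t * z') + p33 * (2 * z t * z'))) (at t)"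
      unfolding P_def y'_def z'_def
      by (auto intro!: derivative_eq_intros x_deriv y_deriv z_deriv simp: algebra_simps)
    also have "- (p11 * (2 * x t * y t) + 2 * p12 * (y t * y t + x t * y') + p22 * (2 * y t * y')
          + 2 * p13 * (y t * z t + x t * z') + 2 * p23 * (y' * z t + y t * z') + p33 * (2 * z t * z'))
        = (x t)\<^sup>2"
    proof -
      \<comment> \<open>Naming the quotients turns the claim into a polynomial identity modulo the
        Lyapunov equations, which \<open>algebra\<close> decides.\<close>
      define a b s e f where "a = g / \<tau>" and "b = 1 / \<tau>" and "s = \<sigma> / \<tau>" and "e = \<sigma> / k" and "f = c / k"
      have "y' = s * z t - a * x t - b * y t" "z' = - e * y t - f * z t"
        by (simp_all add: y'_def z'_def a_def b_def s_def e_def f_def diff_divide_distrib)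
      moreover have "2 * a * p12 = 1" "p11 - b * p12 - a * p22 - e * p13 = 0"
        "s * p12 - f * p13 - a * p23 = 0" "p12 - b * p22 - e * p23 = 0" "s * p23 - f * p33 = 0"
        "s * p22 + p13 - b * p23 - f * p23 - e * p33 = 0"
        unfolding a_def b_def s_def e_def f_def by (rule eqs eq)+
      ultimately show ?thesis by algebra
    qed
    finally show ?thesis .
  qed
  have "(P \<longlongrightarrow> p11 * 0\<^sup>2 + 2 * p12 * (0 * 0) + p22 * 0\<^sup>2
      + 2 * p13 * (0 * 0) + 2 * p23 * (0 * 0) + p33 * 0\<^sup>2) at_top"
    unfolding P_def by (intro tendsto_intros x_tendsto_0 y_tendsto_0 z_tendsto_0)
  then have "((\<lambda>t. - P t) \<longlongrightarrow> 0) at_top"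
    using tendsto_minus by fastforce
  moreover have "continuous_on UNIV x"
    using x_deriv by (intro continuous_at_imp_continuous_on ballI DERIV_isCont)
  then have "continuous_on UNIV (\<lambda>t. (x t)\<^sup>2)" by (intro continuous_intros)
  ultimately have "((\<lambda>t. (x t)\<^sup>2) has_integral (0 - - P 0)) {0..}"
    using P_deriv by (intro has_integral_FTC_atLeast_nonneg) auto
  moreover have "P 0 = X / (2 * g * D)"
  proof -
    \<comment> \<open>Only \<open>y\<close> is nonzero at time \<open>0\<close>, so
      \<open>P 0\<close> is \<open>p22 / \<tau>\<^sup>2\<close>.\<close>
    have "P 0 = (p12 - \<sigma> / k * p23) / \<tau>"
      using pos by (simp add: P_def init p22_def power2_eq_square field_simps)
    also have "\<dots> = p12 * (D - \<sigma>\<^sup>2 * (\<tau> * c + k)) / (\<tau> * D)"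
      using pos D by (simp add: p23_def field_simps power2_eq_square)
    also have "\<dots> = X / (2 * g * D)"
    proof -
      have "D - \<sigma>\<^sup>2 * (\<tau> * c + k) = X" by (simp add: D_def)
      then show ?thesis using pos by (simp add: p12_def)
    qed
    finally show ?thesis .
  qed
  ultimately show ?thesis by (simp add: D_def)
qed

end

section \<open>Matrix exponentials and power series\<close>

text \<open>In finite dimension every bilinear map is bounded. The resulting constant replaces
  submultiplicativity of the norm when the exponential series is estimated.\<close>

lemma bounded_bilinear_matrix_mult:
  "bounded_bilinear ((**) :: real^'n^'m \<Rightarrow> real^'p^'n \<Rightarrow> real^'p^'m)"
  unfolding bilinear_conv_bounded_bilinear[symmetric] bilinear_def
  by (auto intro!: linearI simp: matrix_matrix_mult_def vec_eq_iff sum.distrib sum_distrib_left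
      algebra_simps)

lemma mpow_scaleR: "mpow (t *\<^sub>R A) n = t ^ n *\<^sub>R mpow A n"
  by (induction n) (simp_all add: matrix_matrix_mult_def vec_eq_iff sum_distrib_left mult_ac)

text \<open>\<open>mexp\<close> is defined by an infinite sum, so convergence must be shown before
  it can be used; a scalar exponential series dominates it.\<close>

lemma mexp_sums:
  fixes A :: "real^'a^'a"
  shows "(\<lambda>n. (1 / fact n) *\<^sub>R mpow A n) sums mexp A"
proof -
  obtain K where K: "K > 0" "\<And>(M :: real^'a^'a) (N :: real^'a^'a). norm (M ** N) \<le> norm M * norm N * K"
    using bounded_bilinear.pos_bounded[OF bounded_bilinear_matrix_mult] by blast
  have bound: "norm (mpow A n) \<le> norm (mat 1 :: real^'a^'a) * (K * norm A) ^ n" for n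
  proof (induction n)
    case (Suc n)
    have "norm (mpow A (Suc n)) \<le> norm A * norm (mpow A n) * K"
      using K(2)[of A "mpow A n"] by simp
    also have "\<dots> \<le> norm A * (norm (mat 1 :: real^'a^'a) * (K * norm A) ^ n) * K"
      using Suc K by (intro mult_right_mono mult_left_mono) auto
    finally show ?case by (simp add: mult_ac)
  qed simp
  have "summable (\<lambda>n. (1 / fact n) *\<^sub>R mpow A n)"
  proof (rule summable_comparison_test)
    show "summable (\<lambda>n. norm (mat 1 :: real^'a^'a) * (inverse (fact n) * (K * norm A) ^ n))"
      by (intro summable_mult summable_exp)
    show "\<exists>N. \<forall>n\<ge>N. norm ((1 / fact n) *\<^sub>R mpow A n)
        \<le> norm (mat 1 :: real^'a^'a) * (inverse (fact n) * (K * norm A) ^ n)"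
      using bound by (simp add: field_simps)
  qed
  then show ?thesis by (simp add: mexp_def summable_sums)
qed

text \<open>The map taking \<open>M\<close> to \<open>C *v (M *v (B *v v))\<close> is bounded linear
  and can be applied to the exponential series term by term. If all terms are multiples of one
  vector \<open>w\<close>, a scalar series remains.\<close>

lemma mexp_sandwich_eq:
  fixes A :: "real^'s^'s" and B :: "real^'u^'s" and C :: "real^'s^'y"
  assumes "\<And>n. C *v (mpow A n *v (B *v v)) = p n *\<^sub>R w"
    and "(\<lambda>n. p n / fact n * t ^ n) sums x"
  shows "(C ** mexp (t *\<^sub>R A) ** B) *v v = x *\<^sub>R w"
proof -
  have "bounded_linear (\<lambda>M :: real^'s^'s. C *v (M *v (B *v v)))"
    unfolding linear_conv_bounded_linear[symmetric]
    by (rule linearI)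
      (simp_all add: matrix_vector_mult_add_rdistrib matrix_vector_right_distrib
        scaleR_matrix_vector_assoc[symmetric] matrix_vector_mult_scaleR)
  from bounded_linear.sums[OF this mexp_sums[of "t *\<^sub>R A"]]
  have "(\<lambda>n. (p n / fact n * t ^ n) *\<^sub>R w) sums (C *v (mexp (t *\<^sub>R A) *v (B *v v)))"
    by (simp add: mpow_scaleR scaleR_matrix_vector_assoc[symmetric] matrix_vector_mult_scaleR
        assms(1) mult_ac)
  moreover have "(\<lambda>n. (p n / fact n * t ^ n) *\<^sub>R w) sums (x *\<^sub>R w)"
    using assms(2) by (rule sums_scaleR_left)
  ultimately show ?thesis
    by (metis sums_unique2 matrix_vector_mul_assoc)
qed

text \<open>Differentiating an exponential generating function shifts its coefficient sequence. The
  geometric bound on \<open>p\<close> gives convergence on the whole line.\<close>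

lemma egf_deriv:
  fixes p :: "nat \<Rightarrow> real"
  assumes bound: "\<And>n. \<bar>p n\<bar> \<le> K * M ^ n"
  shows egf_summable: "summable (\<lambda>n. p n / fact n * t ^ n)"
    and egf_has_deriv: "((\<lambda>t. \<Sum>n. p n / fact n * t ^ n) has_real_derivative
      (\<Sum>n. p (Suc n) / fact n * t ^ n)) (at t)"
proof -
  show sm: "summable (\<lambda>n. p n / fact n * t ^ n)" for t
  proof (rule summable_comparison_test)
    show "summable (\<lambda>n. K * (inverse (fact n) * (M * \<bar>t\<bar>) ^ n))"
      by (intro summable_mult summable_exp)
    have "\<bar>p n\<bar> * \<bar>t\<bar> ^ n \<le> K * M ^ n * \<bar>t\<bar> ^ n" for n
      using bound by (intro mult_right_mono) auto
    then show "\<exists>N. \<forall>n\<ge>N. norm (p n / fact n * t ^ n) \<le> K * (inverse (fact n) * (M * \<bar>t\<bar>) ^ n)"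
      by (simp add: abs_mult power_abs field_simps)
  qed
  have "diffs (\<lambda>n. p n / fact n) n = p (Suc n) / fact n" for n
    by (simp add: diffs_def field_simps del: of_nat_Suc)
  then show "((\<lambda>t. \<Sum>n. p n / fact n * t ^ n) has_real_derivative
      (\<Sum>n. p (Suc n) / fact n * t ^ n)) (at t)"
    using termdiffs_strong_converges_everywhere[of "\<lambda>n. p n / fact n" t] sm by simp
qed

text \<open>The Taylor coefficients at \<open>0\<close> of the solution of the modal system with impulse input \<open>y(0) = 1 / \<tau>\<close>.\<close>

primrec modal_seq :: "real \<Rightarrow> real \<Rightarrow> real \<Rightarrow> real \<Rightarrow> real \<Rightarrow> nat \<Rightarrow> real \<times> real \<times> real" where
  "modal_seq g \<tau> k c \<sigma> 0 = (0, 1 / \<tau>, 0)"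
| "modal_seq g \<tau> k c \<sigma> (Suc n) = (case modal_seq g \<tau> k c \<sigma> n of
     (x, y, z) \<Rightarrow> (y, (\<sigma> * z - g * x - y) / \<tau>, (- \<sigma> * y - c * z) / k))"

definition modal_response :: "real \<Rightarrow> real \<Rightarrow> real \<Rightarrow> real \<Rightarrow> real \<Rightarrow> real \<Rightarrow> real" where
  "modal_response g \<tau> k c \<sigma> t = (\<Sum>n. fst (modal_seq g \<tau> k c \<sigma> n) / fact n * t ^ n)"

lemma modal_seq_bound:
  assumes "\<tau> > 0" "k > 0"
  obtains K M where "\<And>n. \<bar>fst (modal_seq g \<tau> k c \<sigma> n)\<bar> \<le> K * M ^ n"
    "\<And>n. \<bar>fst (snd (modal_seq g \<tau> k c \<sigma> n))\<bar> \<le> K * M ^ n"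
    "\<And>n. \<bar>snd (snd (modal_seq g \<tau> k c \<sigma> n))\<bar> \<le> K * M ^ n"
proof -
  define K where "K = 1 / \<tau>"
  \<comment> \<open>The summands are the absolute row sums of the modal system matrix, so one step
    of the recursion enlarges the maximum norm by at most the factor \<open>M\<close>.\<close>
  define M where "M = 1 + (\<bar>\<sigma>\<bar> + \<bar>g\<bar> + 1) / \<tau> + (\<bar>\<sigma>\<bar> + \<bar>c\<bar>) / k"
  have M: "1 \<le> M" "(\<bar>\<sigma>\<bar> + \<bar>g\<bar> + 1) / \<tau> \<le> M" "(\<bar>\<sigma>\<bar> + \<bar>c\<bar>) / k \<le> M"
    using assms by (auto simp: M_def)
  have "\<bar>fst (modal_seq g \<tau> k c \<sigma> n)\<bar> \<le> K * M ^ n \<and> \<bar>fst (snd (modal_seq g \<tau> k c \<sigma> n))\<bar> \<le> K * M ^ n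
      \<and> \<bar>snd (snd (modal_seq g \<tau> k c \<sigma> n))\<bar> \<le> K * M ^ n" for n
  proof (induction n)
    case 0
    then show ?case using assms by (simp add: K_def)
  next
    case (Suc n)
    obtain x y z where xyz: "modal_seq g \<tau> k c \<sigma> n = (x, y, z)" by (metis prod_cases3)
    define b where "b = K * M ^ n"
    have IH: "\<bar>x\<bar> \<le> b" "\<bar>y\<bar> \<le> b" "\<bar>z\<bar> \<le> b" using Suc by (auto simp: xyz b_def)
    then have b: "0 \<le> b" by linarith
    have scaled: "r * b \<le> K * M ^ Suc n" if "r \<le> M" for r
      using mult_right_mono[OF that b] by (simp add: b_def mult_ac)
    have s: "\<bar>\<sigma> * z\<bar> \<le> \<bar>\<sigma>\<bar> * b" "\<bar>g * x\<bar> \<le> \<bar>g\<bar> * b" "\<bar>\<sigma> * y\<bar> \<le> \<bar>\<sigma>\<bar> * b" "\<bar>c * z\<bar> \<le> \<bar>c\<bar> * b"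
      using IH by (simp_all add: abs_mult mult_left_mono)
    have "\<bar>\<sigma> * z - g * x - y\<bar> \<le> (\<bar>\<sigma>\<bar> + \<bar>g\<bar> + 1) * b"
      using s IH(2) unfolding distrib_right by linarith
    then have 2: "\<bar>(\<sigma> * z - g * x - y) / \<tau>\<bar> \<le> (\<bar>\<sigma>\<bar> + \<bar>g\<bar> + 1) / \<tau> * b"
      using assms by (simp add: divide_right_mono)
    have "\<bar>- \<sigma> * y - c * z\<bar> \<le> (\<bar>\<sigma>\<bar> + \<bar>c\<bar>) * b"
      using s unfolding distrib_right by linarith
    then have 3: "\<bar>(- \<sigma> * y - c * z) / k\<bar> \<le> (\<bar>\<sigma>\<bar> + \<bar>c\<bar>) / k * b"
      using assms by (simp add: divide_right_mono)
    show ?case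
      using scaled[OF M(1)] scaled[OF M(2)] scaled[OF M(3)] IH(2) 2 3 by (simp add: xyz)
  qed
  then show thesis using that by blast
qed

text \<open>The recursion of \<open>modal_seq\<close> is the modal differential equation read off on
  Taylor coefficients. Its three generating functions therefore form a \<open>modal_system\<close>
  with the impulse as initial state.\<close>

lemma has_integral_modal_response_square:
  assumes pos: "g > 0" "\<tau> > 0" "k > 0" "c > 0"
  defines "X \<equiv> c * (\<tau> * c + k) + k\<^sup>2 * g"
  shows "((\<lambda>t. (modal_response g \<tau> k c \<sigma> t)\<^sup>2) has_integral
    X / (2 * g * (X + \<sigma>\<^sup>2 * (\<tau> * c + k)))) {0..}"
proof -
  define p q r where "p n = fst (modal_seq g \<tau> k c \<sigma> n)"
    and "q n = fst (snd (modal_seq g \<tau> k c \<sigma> n))"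
    and "r n = snd (snd (modal_seq g \<tau> k c \<sigma> n))" for n
  obtain K M where bounds: "\<And>n. \<bar>p n\<bar> \<le> K * M ^ n" "\<And>n. \<bar>q n\<bar> \<le> K * M ^ n" "\<And>n. \<bar>r n\<bar> \<le> K * M ^ n"
    using modal_seq_bound[OF pos(2,3), of g c \<sigma>] unfolding p_def q_def r_def by metis
  have init: "p 0 = 0" "q 0 = 1 / \<tau>" "r 0 = 0"
    by (simp_all add: p_def q_def r_def)
  have step: "p (Suc n) = q n" "q (Suc n) = (\<sigma> * r n - g * p n - q n) / \<tau>"
    "r (Suc n) = (- \<sigma> * q n - c * r n) / k" for n
    by (simp_all add: p_def q_def r_def split: prod.splits)
  define x y z where "x t = (\<Sum>n. p n / fact n * t ^ n)" and "y t = (\<Sum>n. q n / fact n * t ^ n)"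
    and "z t = (\<Sum>n. r n / fact n * t ^ n)" for t
  have y_eq: "(\<lambda>t. \<Sum>n. q n / fact n * t ^ n) = y" and z_eq: "(\<lambda>t. \<Sum>n. r n / fact n * t ^ n) = z"
    by (simp_all add: fun_eq_iff y_def z_def)
  have sums: "(\<lambda>n. p n / fact n * t ^ n) sums x t" "(\<lambda>n. q n / fact n * t ^ n) sums y t"
    "(\<lambda>n. r n / fact n * t ^ n) sums z t" for t
    unfolding x_def y_def z_def using bounds by (blast intro: summable_sums egf_summable)+
  interpret modal_system g \<tau> k c \<sigma> x y z
  proof
    fix t
    show "(x has_real_derivative y t) (at t)"
      using egf_has_deriv[of p, OF bounds(1)] unfolding x_def y_def by (simp only: step)
    have "(\<lambda>n. q (Suc n) / fact n * t ^ n) sums ((\<sigma> * z t - g * x t - y t) / \<tau>)"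
    proof -
      have "(\<lambda>n. (\<sigma> * (r n / fact n * t ^ n) - g * (p n / fact n * t ^ n) - q n / fact n * t ^ n) / \<tau>)
          sums ((\<sigma> * z t - g * x t - y t) / \<tau>)"
        by (intro sums_divide sums_diff sums_mult sums)
      then show ?thesis
        by (rule sums_cong[THEN iffD1, rotated])
          (simp add: step diff_divide_distrib add_divide_distrib algebra_simps)
    qed
    then show "(y has_real_derivative (\<sigma> * z t - g * x t - y t) / \<tau>) (at t)"
      using egf_has_deriv[of q, OF bounds(2), of t] by (simp only: y_eq sums_iff)
    have "(\<lambda>n. r (Suc n) / fact n * t ^ n) sums ((- \<sigma> * y t - c * z t) / k)"
    proof -
      have "(\<lambda>n. (- \<sigma> * (q n / fact n * t ^ n) - c * (r n / fact n * t ^ n)) / k)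
          sums ((- \<sigma> * y t - c * z t) / k)"
        by (intro sums_divide sums_diff sums_mult sums)
      then show ?thesis
        by (rule sums_cong[THEN iffD1, rotated])
          (simp add: step diff_divide_distrib add_divide_distrib algebra_simps)
    qed
    then show "(z has_real_derivative (- \<sigma> * y t - c * z t) / k) (at t)"
      using egf_has_deriv[of r, OF bounds(3), of t] by (simp only: z_eq sums_iff)
  qed (use pos in auto)
  have "((\<lambda>t. (x t)\<^sup>2) has_integral X / (2 * g * (X + \<sigma>\<^sup>2 * (\<tau> * c + k)))) {0..}"
    unfolding X_def
  proof (rule has_integral_square)
    show "x 0 = 0" "y 0 = 1 / \<tau>" "z 0 = 0"
      unfolding x_def y_def z_def powser_zero by (simp_all add: init)
  qed
  moreover have "modal_response g \<tau> k c \<sigma> = x"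
    by (simp add: fun_eq_iff modal_response_def x_def p_def)
  ultimately show ?thesis by simp
qed

lemma modal_response_sums:
  assumes "\<tau> > 0" "k > 0"
  shows "(\<lambda>n. fst (modal_seq g \<tau> k c \<sigma> n) / fact n * t ^ n) sums modal_response g \<tau> k c \<sigma> t"
proof -
  obtain K M where "\<bar>fst (modal_seq g \<tau> k c \<sigma> n)\<bar> \<le> K * M ^ n" for n
    using modal_seq_bound[OF assms, of g c \<sigma>] by metis
  then show ?thesis
    unfolding modal_response_def by (intro summable_sums egf_summable)
qed

text \<open>The trace is expanded over the input directions \<open>u i\<close>. The output
  directions \<open>w i\<close> may be arbitrary, since only their norms enter.\<close>

lemma (in orthonormal_eigenbasis) has_h2_norm_sqI:
  fixes F :: "real^'s^'s" and B :: "real^'n^'s" and C :: "real^'s^'y"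
  assumes out: "\<And>i t. (C ** mexp (t *\<^sub>R F) ** B) *v u i = x i t *\<^sub>R w i"
    and int: "\<And>i. ((\<lambda>t. (norm (w i))\<^sup>2 * (x i t)\<^sup>2) has_integral v i) {0..}"
  shows "has_h2_norm_sq F B C (\<Sum>i\<in>UNIV. v i)"
proof -
  have "h2_integrand F B C t = (\<Sum>i\<in>UNIV. (norm (w i))\<^sup>2 * (x i t)\<^sup>2)" for t
  proof -
    have "h2_integrand F B C t = trace ((C ** mexp (t *\<^sub>R F) ** B) ** transpose (C ** mexp (t *\<^sub>R F) ** B))"
      by (simp add: h2_integrand_def matrix_transpose_mul matrix_mul_assoc)
    then show ?thesis
      by (simp add: trace_mult_transpose out power_mult_distrib mult.commute)
  qed
  then have "h2_integrand F B C = (\<lambda>t. \<Sum>i\<in>UNIV. (norm (w i))\<^sup>2 * (x i t)\<^sup>2)" by blast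
  then show ?thesis
    unfolding has_h2_norm_sq_def by (simp add: has_integral_sum int)
qed

section \<open>Block matrices\<close>

lemma sum_UNIV_Plus: "(\<Sum>i\<in>UNIV. f i) = (\<Sum>a\<in>UNIV. f (Inl a)) + (\<Sum>c\<in>UNIV. f (Inr c))"
  for f :: "'a::finite + 'b::finite \<Rightarrow> 'c::comm_monoid_add"
  unfolding UNIV_Plus_UNIV[symmetric] by (subst sum.Plus) (simp_all add: comp_def)

definition vec2 :: "real^'n \<Rightarrow> real^'n \<Rightarrow> real^('n + 'n)" where
  "vec2 x y = (\<chi> i. case i of Inl a \<Rightarrow> x $ a | Inr a \<Rightarrow> y $ a)"

definition vec3 :: "real^'n \<Rightarrow> real^'n \<Rightarrow> real^'n \<Rightarrow> real^('n + 'n + 'n)" where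
  "vec3 x y z = (\<chi> i. case i of Inl a \<Rightarrow> x $ a | Inr (Inl a) \<Rightarrow> y $ a | Inr (Inr a) \<Rightarrow> z $ a)"

lemma sum_idm: "(\<Sum>j\<in>UNIV. idm i j * f j) = f i" for i :: "'n::finite"
proof -
  have "(\<Sum>j\<in>UNIV. idm i j * f j) = (\<Sum>j\<in>UNIV. if i = j then f j else 0)"
    by (rule sum.cong) (auto simp: idm_def)
  then show ?thesis by simp
qed

lemma B_std_mult: "B_std \<tau> *v u = vec2 0 ((1 / \<tau>) *\<^sub>R u)"
  by (auto simp: B_std_def vec2_def matrix_vector_mult_def vec_eq_iff sum_divide_distrib[symmetric] sum_idm
      split: sum.splits)

lemma C_std_mult: "C_std G *v vec2 x y = psd_sqrt G *v x"
  by (simp add: C_std_def vec2_def matrix_vector_mult_def vec_eq_iff sum_UNIV_Plus)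

lemma A_std_mult:
  "A_std m \<tau> L *v vec2 x y = vec2 y (- (m / \<tau>) *\<^sub>R (L *v x) - (1 / \<tau>) *\<^sub>R y)"
  by (auto simp: A_std_def vec2_def matrix_vector_mult_def vec_eq_iff sum_UNIV_Plus sum_idm
      sum_negf sum_divide_distrib[symmetric] sum_distrib_left[symmetric] mult.assoc split: sum.splits)

lemma B_DAPI_mult: "B_DAPI \<tau> *v u = vec3 0 ((1 / \<tau>) *\<^sub>R u) 0"
  by (auto simp: B_DAPI_def vec3_def matrix_vector_mult_def vec_eq_iff sum_divide_distrib[symmetric] sum_idm
      split: sum.splits)

lemma C_DAPI_mult: "C_DAPI G *v vec3 x y z = psd_sqrt G *v x"
  by (simp add: C_DAPI_def vec3_def matrix_vector_mult_def vec_eq_iff sum_UNIV_Plus)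

lemma A_DAPI_mult:
  "A_DAPI m \<tau> k L LC *v vec3 x y z =
    vec3 y (- (m / \<tau>) *\<^sub>R (L *v x) - (1 / \<tau>) *\<^sub>R y + (1 / \<tau>) *\<^sub>R z) (- (1 / k) *\<^sub>R y - (1 / k) *\<^sub>R (LC *v z))"
  by (auto simp: A_DAPI_def vec3_def matrix_vector_mult_def vec_eq_iff sum_UNIV_Plus sum_idm
      sum_negf sum_divide_distrib[symmetric] sum_distrib_left[symmetric] mult.assoc split: sum.splits)

text \<open>States whose blocks are multiples of one eigenvector \<open>u\<close> form an invariant
  subspace, on which the powers act by the scalar recursion. With \<open>\<sigma> = 0\<close> the
  third component stays at its initial value \<open>0\<close>; the two parameters \<open>1\<close>
  are mere positive placeholders for \<open>k\<close> and \<open>c\<close>.\<close>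

lemma mpow_A_std_eigenvector:
  assumes "L *v u = l *\<^sub>R u"
  shows "mpow (A_std m \<tau> L) n *v (B_std \<tau> *v u) =
    (case modal_seq (m * l) \<tau> 1 1 0 n of (x, y, z) \<Rightarrow> vec2 (x *\<^sub>R u) (y *\<^sub>R u))"
proof (induction n)
  case 0
  then show ?case by (simp add: B_std_mult)
next
  case (Suc n)
  obtain x y z where xyz: "modal_seq (m * l) \<tau> 1 1 0 n = (x, y, z)" by (metis prod_cases3)
  have "mpow (A_std m \<tau> L) (Suc n) *v (B_std \<tau> *v u) = A_std m \<tau> L *v vec2 (x *\<^sub>R u) (y *\<^sub>R u)"
    using Suc by (simp add: matrix_vector_mul_assoc[symmetric] xyz)
  also have "\<dots> = vec2 (y *\<^sub>R u) (((- (m * l * x) - y) / \<tau>) *\<^sub>R u)"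
    unfolding A_std_mult
    by (rule arg_cong2[where f = vec2])
      (simp_all add: matrix_vector_mult_scaleR assms vec_eq_iff diff_divide_distrib
        add_divide_distrib algebra_simps)
  finally show ?case by (simp add: xyz)
qed

text \<open>The communication Laplacian is a multiple of \<open>L\<close>, so \<open>u\<close> is an
  eigenvector of both and the three blocks stay multiples of \<open>u\<close>.\<close>

lemma mpow_A_DAPI_eigenvector:
  assumes "L *v u = l *\<^sub>R u"
  shows "mpow (A_DAPI m \<tau> k L (\<gamma> *\<^sub>R L)) n *v (B_DAPI \<tau> *v u) =
    (case modal_seq (m * l) \<tau> k (\<gamma> * l) 1 n of (x, y, z) \<Rightarrow> vec3 (x *\<^sub>R u) (y *\<^sub>R u) (z *\<^sub>R u))"
proof (induction n)
  case 0
  then show ?case by (simp add: B_DAPI_mult)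
next
  case (Suc n)
  obtain x y z where xyz: "modal_seq (m * l) \<tau> k (\<gamma> * l) 1 n = (x, y, z)" by (metis prod_cases3)
  have "mpow (A_DAPI m \<tau> k L (\<gamma> *\<^sub>R L)) (Suc n) *v (B_DAPI \<tau> *v u)
      = A_DAPI m \<tau> k L (\<gamma> *\<^sub>R L) *v vec3 (x *\<^sub>R u) (y *\<^sub>R u) (z *\<^sub>R u)"
    using Suc by (simp add: matrix_vector_mul_assoc[symmetric] xyz)
  also have "\<dots> = vec3 (y *\<^sub>R u) (((z - m * l * x - y) / \<tau>) *\<^sub>R u) (((- y - \<gamma> * l * z) / k) *\<^sub>R u)"
    unfolding A_DAPI_mult
    by (rule arg_cong3[where f = vec3])
      (simp_all add: matrix_vector_mult_scaleR scaleR_matrix_vector_assoc[symmetric] assms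
        vec_eq_iff diff_divide_distrib add_divide_distrib algebra_simps)
  finally show ?case by (simp add: xyz)
qed

section \<open>The Laplacian spectrum\<close>

text \<open>Real polynomials that agree at every point are equal, hence have the same roots with
  multiplicity.\<close>

lemma image_mset_eq_of_prod_linear_eq:
  fixes d :: "'a \<Rightarrow> real" and l :: "'b \<Rightarrow> real"
  assumes "finite I" "finite J"
    and eq: "\<And>x. (\<Prod>i\<in>I. x - d i) = (\<Prod>j\<in>J. x - l j)"
  shows "image_mset d (mset_set I) = image_mset l (mset_set J)"
proof -
  have proots: "proots (\<Prod>i\<in>K. [:- f i, 1:]) = image_mset f (mset_set K)"
    if "finite K" for f :: "'c \<Rightarrow> real" and K
    using that by (induction K) (simp_all add: proots_mult del: mult_pCons_left)
  have "poly (\<Prod>i\<in>I. [:- d i, 1:]) = poly (\<Prod>j\<in>J. [:- l j, 1:])"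
    using eq by (auto simp: fun_eq_iff poly_prod)
  then have "(\<Prod>i\<in>I. [:- d i, 1:]) = (\<Prod>j\<in>J. [:- l j, 1:])"
    by (simp only: poly_eq_poly_eq_iff)
  then show ?thesis using proots assms(1,2) by metis
qed

section \<open>The quadratic form of the Laplacian and its kernel\<close>

context
  fixes E :: "'n::finite \<Rightarrow> 'n \<Rightarrow> bool" and b :: "'n \<Rightarrow> 'n \<Rightarrow> real"
  assumes E_irrefl: "\<And>i. \<not> E i i"
    and E_sym: "\<And>i j. E i j \<Longrightarrow> E j i"
    and b_sym: "\<And>i j. E i j \<Longrightarrow> b i j = b j i"
begin

lemma transpose_laplacian: "transpose (laplacian E b) = laplacian E b"
  using E_sym b_sym by (auto simp: laplacian_def transpose_def vec_eq_iff)

lemma laplacian_mult: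
  "(laplacian E b *v x) $ i = (\<Sum>j\<in>UNIV. if E i j then b i j * (x $ i - x $ j) else 0)"
proof -
  have "(laplacian E b *v x) $ i = (\<Sum>j\<in>UNIV. (if j = i then (\<Sum>k\<in>{k. E i k}. b i k) * x $ i else 0)
      - (if E i j then b i j * x $ j else 0))"
    unfolding laplacian_def matrix_vector_mult_def
    using E_irrefl by (auto intro!: sum.cong)
  also have "\<dots> = (\<Sum>k\<in>{k. E i k}. b i k) * x $ i - (\<Sum>j\<in>UNIV. if E i j then b i j * x $ j else 0)"
    by (simp add: sum_subtractf)
  also have "\<dots> = (\<Sum>j\<in>UNIV. if E i j then b i j * x $ i else 0) - (\<Sum>j\<in>UNIV. if E i j then b i j * x $ j else 0)"
    by (simp add: sum_distrib_right sum.If_cases)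
  also have "\<dots> = (\<Sum>j\<in>UNIV. if E i j then b i j * (x $ i - x $ j) else 0)"
    unfolding sum_subtractf[symmetric] by (rule sum.cong) (auto simp: algebra_simps)
  finally show ?thesis .
qed

text \<open>This is the Dirichlet form of the graph. The factor \<open>2\<close> arises because the
  double sum meets each edge in both directions.\<close>

lemma inner_laplacian:
  "2 * (x \<bullet> (laplacian E b *v x)) = (\<Sum>i\<in>UNIV. \<Sum>j\<in>UNIV. if E i j then b i j * (x $ i - x $ j)\<^sup>2 else 0)"
proof -
  define w where "w i j = (if E i j then b i j else 0)" for i j
  have w_sym: "w i j = w j i" for i j using E_sym b_sym by (auto simp: w_def)
  have 1: "x \<bullet> (laplacian E b *v x) = (\<Sum>i\<in>UNIV. \<Sum>j\<in>UNIV. w i j * (x $ i * (x $ i - x $ j)))"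
    by (auto simp: inner_vec_def laplacian_mult sum_distrib_left w_def intro!: sum.cong)
  \<comment> \<open>Adding this mirrored expression to the original one turns the summands into
    squares.\<close>
  also have "\<dots> = (\<Sum>i\<in>UNIV. \<Sum>j\<in>UNIV. w i j * (x $ j * (x $ j - x $ i)))"
    by (subst sum.swap) (simp add: w_sym)
  finally have 2: "x \<bullet> (laplacian E b *v x) = (\<Sum>i\<in>UNIV. \<Sum>j\<in>UNIV. w i j * (x $ j * (x $ j - x $ i)))" .
  have "2 * (x \<bullet> (laplacian E b *v x))
      = (\<Sum>i\<in>UNIV. \<Sum>j\<in>UNIV. w i j * (x $ i * (x $ i - x $ j)) + w i j * (x $ j * (x $ j - x $ i)))"
    using 1 2 by (simp add: sum.distrib)
  also have "\<dots> = (\<Sum>i\<in>UNIV. \<Sum>j\<in>UNIV. if E i j then b i j * (x $ i - x $ j)\<^sup>2 else 0)"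
    by (intro sum.cong refl) (simp add: w_def power2_eq_square algebra_simps)
  finally show ?thesis .
qed

lemma inner_laplacian_nonneg:
  assumes "\<And>i j. E i j \<Longrightarrow> b i j > 0"
  shows "0 \<le> x \<bullet> (laplacian E b *v x)"
proof -
  have "0 \<le> 2 * (x \<bullet> (laplacian E b *v x))"
    unfolding inner_laplacian using assms by (intro sum_nonneg) (auto simp: less_imp_le)
  then show ?thesis by simp
qed

text \<open>The Dirichlet form vanishes at \<open>x\<close>, so each of its nonnegative terms does.
  Thus \<open>x\<close> agrees across every edge, and along paths everywhere.\<close>

lemma laplacian_kernel_const:
  assumes b_pos: "\<And>i j. E i j \<Longrightarrow> b i j > 0" and connected: "{(i, j). E i j}\<^sup>* = UNIV"
    and ker: "laplacian E b *v x = 0"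
  shows "x $ i = x $ j"
proof -
  have edge: "x $ i = x $ j" if "E i j" for i j
  proof -
    have "(\<Sum>i\<in>UNIV. \<Sum>j\<in>UNIV. if E i j then b i j * (x $ i - x $ j)\<^sup>2 else 0) = 0"
      using inner_laplacian[of x] ker by simp
    moreover have nn: "0 \<le> (if E i j then b i j * (x $ i - x $ j)\<^sup>2 else 0)" for i j
      by (simp add: b_pos less_imp_le)
    ultimately have "(if E i j then b i j * (x $ i - x $ j)\<^sup>2 else 0) = 0"
      by (simp add: sum_nonneg_eq_0_iff sum_nonneg)
    then show ?thesis using that b_pos[OF that] by simp
  qed
  have "(i, j) \<in> {(i, j). E i j}\<^sup>*" by (simp add: connected)
  then show ?thesis by (induction rule: rtrancl_induct) (auto dest: edge)
qed

lemma laplacian_mult_1: "laplacian E b *v 1 = 0"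
  by (simp add: vec_eq_iff laplacian_mult cong: if_cong)

end

locale laplacian_spectrum = orthonormal_eigenbasis "laplacian E b" u d
  for E :: "'n::finite \<Rightarrow> 'n \<Rightarrow> bool" and b u d +
  assumes E_irrefl: "\<And>i. \<not> E i i"
    and E_sym: "\<And>i j. E i j \<Longrightarrow> E j i"
    and b_sym: "\<And>i j. E i j \<Longrightarrow> b i j = b j i"
    and b_pos: "\<And>i j. E i j \<Longrightarrow> b i j > 0"
    and connected: "{(i, j). E i j}\<^sup>* = UNIV"
begin

lemma eigenvalue_nonneg: "0 \<le> d i"
  using inner_laplacian_nonneg[of E b "u i"] E_irrefl E_sym b_sym b_pos
  by (simp add: eigen orthonormal)

text \<open>The all-ones vector lies in the kernel; if no \<open>d i\<close> were zero, it would be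
  orthogonal to the whole basis. Two kernel vectors of the basis would both be constant and nonzero,
  hence not orthogonal.\<close>

lemma ex1_eigenvalue_0: "\<exists>!i. d i = 0"
proof -
  have "\<exists>i. d i = 0"
  proof (rule ccontr)
    assume nz: "\<nexists>i. d i = 0"
    have "u i \<bullet> 1 = 0" for i
    proof -
      have "d i * (u i \<bullet> 1) = (laplacian E b *v u i) \<bullet> 1" by (simp add: eigen)
      also have "\<dots> = u i \<bullet> (laplacian E b *v 1)"
        using E_irrefl E_sym b_sym by (subst symmetric_matrix_inner) (auto intro: transpose_laplacian)
      also have "\<dots> = 0" using E_irrefl E_sym b_sym by (simp add: laplacian_mult_1)
      finally show ?thesis using nz by simp
    qed
    then have "(1 :: real^'n) = 0" by (rule vector_eq_0I)
    then show False by simp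
  qed
  moreover have "i = j" if "d i = 0" "d j = 0" for i j
  proof (rule ccontr)
    assume "i \<noteq> j"
    have const: "u l $ a = u l $ c" if "d l = 0" for l a c
      by (rule laplacian_kernel_const[of E b]) (use E_irrefl E_sym b_sym b_pos connected eigen that in auto)
    obtain a :: 'n where True by blast
    have u: "u l = (\<chi> _. u l $ a)" if "d l = 0" for l
      using const[OF that] by (simp add: vec_eq_iff)
    have prod: "u l \<bullet> u l' = real CARD('n) * (u l $ a * u l' $ a)" if "d l = 0" "d l' = 0" for l l'
      by (subst u[OF that(1)], subst u[OF that(2)]) (simp add: inner_vec_def)
    have "u i $ a * u j $ a = 0" "u i $ a * u i $ a \<noteq> 0" "u j $ a * u j $ a \<noteq> 0"
      using prod[of i j] prod[of i i] prod[of j j] that \<open>i \<noteq> j\<close> by (auto simp: orthonormal)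
    then show False by simp
  qed
  ultimately show ?thesis by blast
qed

text \<open>\<open>lam\<close> and \<open>d\<close> list the same multiset over different index
  types, so sums over functions of the eigenvalues can be transferred.\<close>

lemma sum_eigenvalues:
  fixes lam :: "nat \<Rightarrow> real" and f :: "real \<Rightarrow> 'c::comm_monoid_add"
  assumes eig: "\<And>x. det (mat x - laplacian E b) = (\<Prod>n = 1..CARD('n). x - lam n)"
  shows "(\<Sum>i\<in>UNIV. f (d i)) = (\<Sum>n = 1..CARD('n). f (lam n))"
    and "lam ` {1..CARD('n)} = range d"
proof -
  have eq: "image_mset d (mset_set UNIV) = image_mset lam (mset_set {1..CARD('n)})"
    using eig det_charpoly by (intro image_mset_eq_of_prod_linear_eq) auto
  show "(\<Sum>i\<in>UNIV. f (d i)) = (\<Sum>n = 1..CARD('n). f (lam n))"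
    using arg_cong[OF eq, of "\<lambda>M. \<Sum>\<^sub># (image_mset f M)"]
    by (simp add: sum_unfold_sum_mset image_mset.compositionality comp_def)
  show "lam ` {1..CARD('n)} = range d"
    using arg_cong[OF eq, of set_mset] by simp
qed

lemma sorted_eigenvalues:
  fixes lam :: "nat \<Rightarrow> real"
  assumes eig: "\<And>x. det (mat x - laplacian E b) = (\<Prod>n = 1..CARD('n). x - lam n)"
    and sorted: "\<And>i j. 1 \<le> i \<Longrightarrow> i \<le> j \<Longrightarrow> j \<le> CARD('n) \<Longrightarrow> lam i \<le> lam j"
  shows "lam 1 = 0" and "\<And>n. n \<in> {2..CARD('n)} \<Longrightarrow> lam n > 0"
proof -
  have nonneg: "0 \<le> lam n" if "n \<in> {1..CARD('n)}" for n
    using sum_eigenvalues(2)[OF eig] that eigenvalue_nonneg by (metis image_iff)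
  \<comment> \<open>Summing an indicator function counts zeros with multiplicity, which transfers
    the simplicity of the eigenvalue \<open>0\<close> to \<open>lam\<close>.\<close>
  have "card {i. d i = 0} = card {n \<in> {1..CARD('n)}. lam n = 0}"
    using sum_eigenvalues(1)[OF eig, of "\<lambda>x. if x = 0 then 1 else 0 :: nat"]
    by (simp add: sum.If_cases Int_def)
  moreover have "card {i. d i = 0} = 1"
    using ex1_eigenvalue_0 by (auto simp: card_1_singleton_iff)
  ultimately obtain n0 where n0: "{n \<in> {1..CARD('n)}. lam n = 0} = {n0}"
    by (metis card_1_singletonE)
  then have "n0 \<in> {1..CARD('n)}" "lam n0 = 0" by auto
  then show lam1: "lam 1 = 0" using sorted[of 1 n0] nonneg[of 1] by force
  show "lam n > 0" if "n \<in> {2..CARD('n)}" for n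
  proof -
    have "1 \<in> {n \<in> {1..CARD('n)}. lam n = 0}" using that lam1 by auto
    then have "n0 = 1" unfolding n0 by simp
    then have "n \<notin> {n \<in> {1..CARD('n)}. lam n = 0}" unfolding n0 using that by simp
    then have "lam n \<noteq> 0" using that by simp
    then show ?thesis using nonneg[of n] that by force
  qed
qed

section \<open>The H2 norms of the two systems\<close>

lemma has_h2_norm_sq_std:
  assumes pos: "m > 0" "\<tau> > 0" "\<alpha> > 0"
  shows "has_h2_norm_sq (A_std m \<tau> (laplacian E b)) (B_std \<tau>) (C_std (\<alpha> *\<^sub>R laplacian E b))
    (\<Sum>i\<in>UNIV. if d i = 0 then 0 else \<alpha> / (2 * m))"
proof (rule has_h2_norm_sqI)
  \<comment> \<open>The output uses the square root of the scaled Laplacian, which has the same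
    eigenbasis.\<close>
  interpret scaled: orthonormal_eigenbasis "\<alpha> *\<^sub>R laplacian E b" u "\<lambda>i. \<alpha> * d i"
    by unfold_locales (simp_all add: orthonormal eigen scaleR_matrix_vector_assoc[symmetric])
  fix i t
  show "(C_std (\<alpha> *\<^sub>R laplacian E b) ** mexp (t *\<^sub>R A_std m \<tau> (laplacian E b)) ** B_std \<tau>) *v u i
      = modal_response (m * d i) \<tau> 1 1 0 t *\<^sub>R (sqrt (\<alpha> * d i) *\<^sub>R u i)"
    by (rule mexp_sandwich_eq[OF _ modal_response_sums])
      (use pos eigenvalue_nonneg in \<open>simp_all add: mpow_A_std_eigenvector[OF eigen] C_std_mult
        matrix_vector_mult_scaleR scaled.psd_sqrt_eigen split: prod.splits\<close>)
  have norm: "(norm (sqrt (\<alpha> * d i) *\<^sub>R u i))\<^sup>2 = \<alpha> * d i"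
    using pos eigenvalue_nonneg[of i] orthonormal[of i i] by (simp add: norm_eq_sqrt_inner)
  show "((\<lambda>t. (norm (sqrt (\<alpha> * d i) *\<^sub>R u i))\<^sup>2 * (modal_response (m * d i) \<tau> 1 1 0 t)\<^sup>2)
      has_integral (if d i = 0 then 0 else \<alpha> / (2 * m))) {0..}"
  proof (cases "d i = 0")
    case False
    then have "d i > 0" using eigenvalue_nonneg[of i] by simp
    \<comment> \<open>For \<open>k = c = 1\<close> and \<open>\<sigma> = 0\<close> this is the
      quantity \<open>X\<close> that cancels. The factor \<open>d i\<close> cancels as well, so
      every nonzero mode contributes the same amount.\<close>
    moreover have "\<tau> + 1 + m * d i > 0" using pos \<open>d i > 0\<close> by (simp add: add_pos_pos)
    ultimately show ?thesis
      unfolding norm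
      using has_integral_mult_right[OF has_integral_modal_response_square[of "m * d i" \<tau> 1 1 0], of "\<alpha> * d i"] pos
      by simp
  qed simp
qed

lemma has_h2_norm_sq_DAPI:
  assumes pos: "m > 0" "\<tau> > 0" "k > 0" "\<alpha> > 0" "\<gamma> > 0"
  shows "has_h2_norm_sq (A_DAPI m \<tau> k (laplacian E b) (\<gamma> *\<^sub>R laplacian E b)) (B_DAPI \<tau>)
    (C_DAPI (\<alpha> *\<^sub>R laplacian E b))
    (\<Sum>i\<in>UNIV. if d i = 0 then 0 else \<alpha> / (2 * m) * (1 / (1 + (\<gamma> * \<tau> * d i + k) /
      (\<gamma> * d i * (\<gamma> * \<tau> * d i + k) + k^2 * m * d i))))"
proof (rule has_h2_norm_sqI)
  interpret scaled: orthonormal_eigenbasis "\<alpha> *\<^sub>R laplacian E b" u "\<lambda>i. \<alpha> * d i"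
    by unfold_locales (simp_all add: orthonormal eigen scaleR_matrix_vector_assoc[symmetric])
  fix i t
  show "(C_DAPI (\<alpha> *\<^sub>R laplacian E b) ** mexp (t *\<^sub>R A_DAPI m \<tau> k (laplacian E b) (\<gamma> *\<^sub>R laplacian E b))
      ** B_DAPI \<tau>) *v u i = modal_response (m * d i) \<tau> k (\<gamma> * d i) 1 t *\<^sub>R (sqrt (\<alpha> * d i) *\<^sub>R u i)"
    by (rule mexp_sandwich_eq[OF _ modal_response_sums])
      (use pos eigenvalue_nonneg in \<open>simp_all add: mpow_A_DAPI_eigenvector[OF eigen] C_DAPI_mult
        matrix_vector_mult_scaleR scaled.psd_sqrt_eigen split: prod.splits\<close>)
  have norm: "(norm (sqrt (\<alpha> * d i) *\<^sub>R u i))\<^sup>2 = \<alpha> * d i"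
    using pos eigenvalue_nonneg[of i] orthonormal[of i i] by (simp add: norm_eq_sqrt_inner)
  show "((\<lambda>t. (norm (sqrt (\<alpha> * d i) *\<^sub>R u i))\<^sup>2 * (modal_response (m * d i) \<tau> k (\<gamma> * d i) 1 t)\<^sup>2)
      has_integral (if d i = 0 then 0 else \<alpha> / (2 * m) * (1 / (1 + (\<gamma> * \<tau> * d i + k) /
      (\<gamma> * d i * (\<gamma> * \<tau> * d i + k) + k^2 * m * d i))))) {0..}"
  proof (cases "d i = 0")
    case False
    then have d: "d i > 0" using eigenvalue_nonneg[of i] by simp
    \<comment> \<open>The eigenvalue cancels from the prefactor, leaving
      \<open>\<alpha> / (2 * m)\<close> times \<open>X / (X + Y)\<close>.\<close>
    define X where "X = \<gamma> * d i * (\<tau> * (\<gamma> * d i) + k) + k\<^sup>2 * (m * d i)"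
    define Y where "Y = \<tau> * (\<gamma> * d i) + k"
    have XY: "X > 0" "Y > 0"
      unfolding X_def Y_def using pos d by (auto intro!: add_pos_pos mult_pos_pos)
    have "((\<lambda>t. \<alpha> * d i * (modal_response (m * d i) \<tau> k (\<gamma> * d i) 1 t)\<^sup>2)
        has_integral \<alpha> * d i * (X / (2 * (m * d i) * (X + 1\<^sup>2 * Y)))) {0..}"
      unfolding X_def Y_def using pos d
      by (intro has_integral_mult_right has_integral_modal_response_square) auto
    also have "\<alpha> * d i * (X / (2 * (m * d i) * (X + 1\<^sup>2 * Y))) = \<alpha> / (2 * m) * (X / (X + Y))"
      using d by simp
    also have "X / (X + Y) = 1 / (1 + Y / X)"
      using XY by (simp add: field_simps)
    also have "Y / X = (\<gamma> * \<tau> * d i + k) / (\<gamma> * d i * (\<gamma> * \<tau> * d i + k) + k^2 * m * d i)"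
      by (simp add: X_def Y_def mult_ac)
    finally show ?thesis unfolding norm using False by simp
  qed simp
qed

end

theorem theorem1:
  fixes E :: "'n::finite \<Rightarrow> 'n \<Rightarrow> bool"
    and b :: "'n \<Rightarrow> 'n \<Rightarrow> real"
    and lam :: "nat \<Rightarrow> real"
    and m \<tau> k \<alpha> \<gamma> :: real
  assumes N2: "CARD('n) \<ge> 2"
    and E_irrefl: "\<And>i. \<not> E i i"
    and E_sym: "\<And>i j. E i j \<Longrightarrow> E j i"
    and b_sym: "\<And>i j. E i j \<Longrightarrow> b i j = b j i"
    and b_pos: "\<And>i j. E i j \<Longrightarrow> b i j > 0"
    and connected: "{(i, j). E i j}\<^sup>* = UNIV"
    and eig: "\<And>x. det (mat x - laplacian E b) = (\<Prod>n = 1..CARD('n). x - lam n)"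
    and eig_sorted: "\<And>i j. 1 \<le> i \<Longrightarrow> i \<le> j \<Longrightarrow> j \<le> CARD('n) \<Longrightarrow> lam i \<le> lam j"
    and pos: "m > 0" "\<tau> > 0" "k > 0" "\<alpha> > 0" "\<gamma> > 0"
  shows "has_h2_norm_sq (A_std m \<tau> (laplacian E b)) (B_std \<tau>)
           (C_std (\<alpha> *\<^sub>R laplacian E b))
           (\<alpha> / (2 * m) * (real CARD('n) - 1))
       \<and> has_h2_norm_sq (A_DAPI m \<tau> k (laplacian E b) (\<gamma> *\<^sub>R laplacian E b)) (B_DAPI \<tau>)
           (C_DAPI (\<alpha> *\<^sub>R laplacian E b))
           (\<alpha> / (2 * m) * (\<Sum>n = 2..CARD('n).
              1 / (1 + (\<gamma> * \<tau> * lam n + k) /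
                       (\<gamma> * lam n * (\<gamma> * \<tau> * lam n + k) + k^2 * m * lam n))))"
proof -
  have "transpose (laplacian E b) = laplacian E b"
    by (rule transpose_laplacian[OF E_irrefl E_sym b_sym])
  then obtain u :: "'n \<Rightarrow> real^'n" and d
    where ud: "\<And>i j. u i \<bullet> u j = (if i = j then 1 else 0)" "\<And>i. laplacian E b *v u i = d i *\<^sub>R u i"
    by (rule symmetric_matrix_orthonormal_eigenbasis) blast
  interpret laplacian_spectrum E b u d
    using assms ud by unfold_locales auto
  note lam = sorted_eigenvalues[OF eig eig_sorted]
  \<comment> \<open>The zero mode is singled out by its eigenvalue and not by its index, so the sum
    can be rewritten over \<open>lam\<close>; sorting then puts the zero at index
    \<open>1\<close>.\<close>
  have sum: "(\<Sum>i\<in>UNIV. if d i = 0 then 0 else f (d i)) = (\<Sum>n = 2..CARD('n). f (lam n))"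
    for f :: "real \<Rightarrow> real"
  proof -
    have "(\<Sum>i\<in>UNIV. if d i = 0 then 0 else f (d i)) = (\<Sum>n = 1..CARD('n). if lam n = 0 then 0 else f (lam n))"
      using sum_eigenvalues(1)[OF eig, of "\<lambda>x. if x = 0 then 0 else f x"] .
    also have "\<dots> = (\<Sum>n = 2..CARD('n). if lam n = 0 then 0 else f (lam n))"
      using N2 lam(1) by (subst sum.atLeast_Suc_atMost) (auto simp: numeral_2_eq_2)
    also have "\<dots> = (\<Sum>n = 2..CARD('n). f (lam n))"
      using lam(2) by (intro sum.cong) force+
    finally show ?thesis .
  qed
  have "(\<Sum>n = 2..CARD('n). \<alpha> / (2 * m)) = \<alpha> / (2 * m) * (real CARD('n) - 1)"
    using N2 by (simp add: of_nat_diff)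
  then have "has_h2_norm_sq (A_std m \<tau> (laplacian E b)) (B_std \<tau>)
      (C_std (\<alpha> *\<^sub>R laplacian E b)) (\<alpha> / (2 * m) * (real CARD('n) - 1))"
    using has_h2_norm_sq_std[OF pos(1,2,4)] sum[of "\<lambda>_. \<alpha> / (2 * m)"] by metis
  then show ?thesis
    using has_h2_norm_sq_DAPI[OF pos]
    unfolding sum_distrib_left sum[of "\<lambda>l. \<alpha> / (2 * m) * (1 / (1 + (\<gamma> * \<tau> * l + k) /
      (\<gamma> * l * (\<gamma> * \<tau> * l + k) + k^2 * m * l)))"] by (rule conjI)
qed

end
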